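(* Let $P\in\mathsf{pGCL}^{\boxtimes}$ be a fully probabilistic program without observations, let $f:\mathbb S\to[0,\infty]$ and $g:\mathbb S\to[0,1]$. Then $$\mathsf{wp}[P](f)=\underline{\mathsf{cwp}}[P](f)\qquad\text{and}\qquad\mathsf{wlp}[P](g)=\underline{\mathsf{cwlp}}[P](g).$$
   Context: **Programs.** $\mathbb S$ is the set of program states (valuations of program variables). $\mathsf{cpGCL}^{\boxtimes}$ is the set of programs generated by $$P::=\mathtt{skip}\mid\mathtt{abort}\mid x:=E\mid \mathtt{observe}\,G\mid P;P\mid \mathtt{ite}(G)\{P\}\{P\}\mid\{P\}[p]\{P\}\mid\mathtt{while}(G)\{P\},$$ with $x$ a variable, $E$ an arithmetic expression, $G$ a Boolean expression over the variables, $p\in[0,1]$. $\mathsf{pGCL}^{\boxtimes}\subseteq\mathsf{cpGCL}^{\boxtimes}$ is the set of those programs containing no $\mathtt{observe}$ statement. **Expectations.** $\mathbb E=\{f:\mathbb S\to[0,\infty]\}$, $\mathbb E_{\le1}=\{g:\mathbb S\to[0,1]\}$, ordered pointwise by $\sqsubseteq$. $\mathbf 0,\mathbf 1$ are constant functions; $\chi_G$ is the indicator of $G$; $f[x/E](\sigma)=f(\sigma[x\leftarrow E(\sigma)])$; arithmetic is pointwise with $0\cdot\infty=0$. **wp and wlp.** $\mathsf{wp}[P]:\mathbb E\to\mathbb E$: $\mathsf{wp}[\mathtt{skip}](f)=f$; $\mathsf{wp}[\mathtt{abort}](f)=\mathbf0$; $\mathsf{wp}[x:=E](f)=f[x/E]$;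 $\mathsf{wp}[P_1;P_2]=\mathsf{wp}[P_1]\circ\mathsf{wp}[P_2]$; $\mathsf{wp}[\mathtt{ite}(G)\{P_1\}\{P_2\}](f)=\chi_G\cdot\mathsf{wp}[P_1](f)+\chi_{\neg G}\cdot\mathsf{wp}[P_2](f)$; $\mathsf{wp}[\{P_1\}[p]\{P_2\}](f)=p\cdot\mathsf{wp}[P_1](f)+(1-p)\cdot\mathsf{wp}[P_2](f)$; $\mathsf{wp}[\mathtt{while}(G)\{P'\}](f)$ is the least fixed point of $\hat f\mapsto\chi_G\cdot\mathsf{wp}[P'](\hat f)+\chi_{\neg G}\cdot f$ in $(\mathbb E,\sqsubseteq)$. $\mathsf{wlp}[P]:\mathbb E_{\le1}\to\mathbb E_{\le1}$ follows the same rules (with $\mathsf{wlp}$ for $\mathsf{wp}$) except $\mathsf{wlp}[\mathtt{abort}](f)=\mathbf1$ and $\mathsf{wlp}[\mathtt{while}(G)\{P'\}](f)$ is the greatest fixed point of $\hat f\mapsto\chi_G\cdot\mathsf{wlp}[P'](\hat f)+\chi_{\neg G}\cdot f$ in $(\mathbb E_{\le1},\sqsubseteq)$. **cwp and cwlp.** $\mathsf{cwp}[P]:\mathbb E\times\mathbb E_{\le1}\to\mathbb E\times\mathbb E_{\le1}$ (sums and scalar multiples componentwise): $\mathsf{cwp}[\mathtt{skip}](f,g)=(f,g)$; $\mathsf{cwp}[\mathtt{abort}](f,g)=(\mathbf0,\mathbf1)$; $\mathsf{cwp}[x:=E](f,g)=(f[x/E],g[x/E])$; $\mathsf{cwp}[\mathtt{observe}\,G](f,g)=\chi_G\cdot(f,g)$;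 $\mathsf{cwp}[P_1;P_2]=\mathsf{cwp}[P_1]\circ\mathsf{cwp}[P_2]$; $\mathsf{cwp}[\mathtt{ite}(G)\{P_1\}\{P_2\}](f,g)=\chi_G\cdot\mathsf{cwp}[P_1](f,g)+\chi_{\neg G}\cdot\mathsf{cwp}[P_2](f,g)$; $\mathsf{cwp}[\{P_1\}[p]\{P_2\}](f,g)=p\cdot\mathsf{cwp}[P_1](f,g)+(1-p)\cdot\mathsf{cwp}[P_2](f,g)$; $\mathsf{cwp}[\mathtt{while}(G)\{P'\}](f,g)$ is the least fixed point w.r.t. $(\sqsubseteq,\sqsupseteq)$ of $(\hat f,\hat g)\mapsto\chi_G\cdot\mathsf{cwp}[P'](\hat f,\hat g)+\chi_{\neg G}\cdot(f,g)$. $\mathsf{cwlp}[P]$ on $\mathbb E_{\le1}\times\mathbb E_{\le1}$ follows the same rules (with $\mathsf{cwlp}$ for $\mathsf{cwp}$) except $\mathsf{cwlp}[\mathtt{abort}](f,g)=(\mathbf1,\mathbf1)$ and the loop is the greatest fixed point w.r.t. $(\sqsubseteq,\sqsubseteq)$ of $(\hat f,\hat g)\mapsto\chi_G\cdot\mathsf{cwlp}[P'](\hat f,\hat g)+\chi_{\neg G}\cdot(f,g)$. With $\mathsf{cwp}_i,\mathsf{cwlp}_i$ the $i$-th components, $\underline{\mathsf{cwp}}[P](f)=\mathsf{cwp}_1[P](f,\mathbf1)/\mathsf{cwp}_2[P](f,\mathbf1)$ and $\underline{\mathsf{cwlp}}[P](f)=\mathsf{cwlp}_1[P](f,\mathbf1)/\mathsf{cwlp}_2[P](f,\mathbf1)$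 (undefined where the denominator is $0$; the claim includes that the quotients are defined everywhere). *)

theory Defs
  imports
    "HOL-Library.Extended_Nonnegative_Real"
    "HOL-Library.Product_Order"
    "HOL-Library.Dual_Ordered_Lattice"
begin

text \<open>The unit interval as a complete lattice. It serves both as the codomain of bounded
  expectations and as the range of choice probabilities.\<close>

typedef unit_ival = "{0..1::ennreal}"
  morphisms val unit_of by (rule exI[of _ 0]) simp

setup_lifting type_definition_unit_ival

instantiation unit_ival :: complete_linorder
begin

lift_definition less_eq_unit_ival :: "unit_ival \<Rightarrow> unit_ival \<Rightarrow> bool" is "(\<le>)" .
lift_definition less_unit_ival :: "unit_ival \<Rightarrow> unit_ival \<Rightarrow> bool" is "(<)" .
lift_definition inf_unit_ival :: "unit_ival \<Rightarrow> unit_ival \<Rightarrow> unit_ival" is inf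
  by (auto intro: le_infI1)
lift_definition sup_unit_ival :: "unit_ival \<Rightarrow> unit_ival \<Rightarrow> unit_ival" is sup by auto
lift_definition bot_unit_ival :: unit_ival is 0 by simp
lift_definition top_unit_ival :: unit_ival is 1 by simp

text \<open>The cap at 1 only matters for the empty infimum.\<close>
lift_definition Inf_unit_ival :: "unit_ival set \<Rightarrow> unit_ival" is "\<lambda>A. inf 1 (Inf A)" by simp
lift_definition Sup_unit_ival :: "unit_ival set \<Rightarrow> unit_ival" is Sup
  by (auto intro: Sup_least)

instance
proof
  fix x :: unit_ival and A assume "x \<in> A" then show "Inf A \<le> x"
    by transfer (auto intro: le_infI2 Inf_lower)
next
  fix z :: unit_ival and A assume "\<And>x. x \<in> A \<Longrightarrow> z \<le> x" then show "z \<le> Inf A"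
    by transfer (auto intro: Inf_greatest)
next
  fix x :: unit_ival and A assume "x \<in> A" then show "x \<le> Sup A"
    by transfer (auto intro: Sup_upper)
next
  fix z :: unit_ival and A assume "\<And>x. x \<in> A \<Longrightarrow> x \<le> z" then show "Sup A \<le> z"
    by transfer (auto intro: Sup_least)
next
  show "Inf {} = (top :: unit_ival)" by transfer (simp add: inf_absorb1)
next
  show "Sup {} = (bot :: unit_ival)" by transfer (simp add: bot_ennreal)
qed (transfer; auto)+

end

instantiation unit_ival :: "{zero,one,times}"
begin
lift_definition zero_unit_ival :: unit_ival is 0 by simp
lift_definition one_unit_ival :: unit_ival is 1 by simp
lift_definition times_unit_ival :: "unit_ival \<Rightarrow> unit_ival \<Rightarrow> unit_ival" is "(*)"
  using mult_mono[of _ "1::ennreal" _ 1] by auto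
instance ..
end

text \<open>The unit interval is not closed under addition, but it is closed under convex combinations
  \<open>p * a + (1 - p) * b\<close>.\<close>

lift_definition convex_comb :: "unit_ival \<Rightarrow> unit_ival \<Rightarrow> unit_ival \<Rightarrow> unit_ival" is
  "\<lambda>p a b. p * a + (1 - p) * b"
proof -
  fix p a b :: ennreal
  assume p: "p \<in> {0..1}" and a: "a \<in> {0..1}" and b: "b \<in> {0..1}"
  have "p * a + (1 - p) * b \<le> p * 1 + (1 - p) * 1"
    using a b by (intro add_mono mult_left_mono) auto
  also have "\<dots> = 1" using p by (simp add: add_diff_inverse_ennreal)
  finally show "p * a + (1 - p) * b \<in> {0..1}" by simp
qed

text \<open>Expressions and guards are represented by their denotations, i.e. as functions on states.\<close>

type_synonym ('var, 'v) state = "'var \<Rightarrow> 'v"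

datatype ('var, 'v) prog =
    Skip
  | Abort
  | Assign 'var "('var, 'v) state \<Rightarrow> 'v"
  | Observe "('var, 'v) state \<Rightarrow> bool"
  | Seq "('var, 'v) prog" "('var, 'v) prog"
  | Ite "('var, 'v) state \<Rightarrow> bool" "('var, 'v) prog" "('var, 'v) prog"
  | PChoice "('var, 'v) prog" unit_ival "('var, 'v) prog"
  | While "('var, 'v) state \<Rightarrow> bool" "('var, 'v) prog"

primrec observe_free :: "('var, 'v) prog \<Rightarrow> bool" where
  "observe_free Skip = True"
| "observe_free Abort = True"
| "observe_free (Assign x E) = True"
| "observe_free (Observe G) = False"
| "observe_free (Seq P1 P2) = (observe_free P1 \<and> observe_free P2)"
| "observe_free (Ite G P1 P2) = (observe_free P1 \<and> observe_free P2)"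
| "observe_free (PChoice P1 p P2) = (observe_free P1 \<and> observe_free P2)"
| "observe_free (While G P) = observe_free P"

type_synonym ('var, 'v) expec = "('var, 'v) state \<Rightarrow> ennreal"
type_synonym ('var, 'v) bexpec = "('var, 'v) state \<Rightarrow> unit_ival"

definition subst :: "(('var, 'v) state \<Rightarrow> 'b) \<Rightarrow> 'var \<Rightarrow> (('var, 'v) state \<Rightarrow> 'v)
    \<Rightarrow> ('var, 'v) state \<Rightarrow> 'b" where
  "subst f x E = (\<lambda>\<sigma>. f (\<sigma>(x := E \<sigma>)))"

definition chi :: "(('var, 'v) state \<Rightarrow> bool) \<Rightarrow> ('var, 'v) bexpec" where
  "chi G = (\<lambda>\<sigma>. if G \<sigma> then 1 else 0)"

text \<open>Weighted sums \<open>w \<cdot> f + (1 - w) \<cdot> f'\<close> of expectations, of bounded expectations, and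
  componentwise of pairs. A constant weight gives the probabilistic choice. As
  \<open>1 - \<chi>\<^bsub>G\<^esub> = \<chi>\<^bsub>\<not>G\<^esub>\<close>, the weight \<open>\<chi>\<^bsub>G\<^esub>\<close>
  gives \<open>\<chi>\<^bsub>G\<^esub> \<cdot> f + \<chi>\<^bsub>\<not>G\<^esub> \<cdot> f'\<close>.\<close>

definition mix :: "('var, 'v) bexpec \<Rightarrow> ('var, 'v) expec \<Rightarrow> ('var, 'v) expec \<Rightarrow> ('var, 'v) expec"
  where "mix w f f' = (\<lambda>\<sigma>. val (w \<sigma>) * f \<sigma> + (1 - val (w \<sigma>)) * f' \<sigma>)"

definition bmix :: "('var, 'v) bexpec \<Rightarrow> ('var, 'v) bexpec \<Rightarrow> ('var, 'v) bexpec \<Rightarrow> ('var, 'v) bexpec"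
  where "bmix w g g' = (\<lambda>\<sigma>. convex_comb (w \<sigma>) (g \<sigma>) (g' \<sigma>))"

definition mix_pair :: "('var, 'v) bexpec \<Rightarrow> ('var, 'v) expec \<times> ('var, 'v) bexpec
    \<Rightarrow> ('var, 'v) expec \<times> ('var, 'v) bexpec \<Rightarrow> ('var, 'v) expec \<times> ('var, 'v) bexpec" where
  "mix_pair w = (\<lambda>(f, g) (f', g'). (mix w f f', bmix w g g'))"

definition bmix_pair :: "('var, 'v) bexpec \<Rightarrow> ('var, 'v) bexpec \<times> ('var, 'v) bexpec
    \<Rightarrow> ('var, 'v) bexpec \<times> ('var, 'v) bexpec \<Rightarrow> ('var, 'v) bexpec \<times> ('var, 'v) bexpec" where
  "bmix_pair w = (\<lambda>(f, g) (f', g'). (bmix w f f', bmix w g g'))"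

text \<open>The unconditional transformers are left unspecified on \<open>Observe\<close>.\<close>

primrec (nonexhaustive) wp :: "('var, 'v) prog \<Rightarrow> ('var, 'v) expec \<Rightarrow> ('var, 'v) expec" where
  "wp Skip = (\<lambda>f. f)"
| "wp Abort = (\<lambda>f \<sigma>. 0)"
| "wp (Assign x E) = (\<lambda>f. subst f x E)"
| "wp (Seq P1 P2) = wp P1 \<circ> wp P2"
| "wp (Ite G P1 P2) = (\<lambda>f. mix (chi G) (wp P1 f) (wp P2 f))"
| "wp (PChoice P1 p P2) = (\<lambda>f. mix (\<lambda>\<sigma>. p) (wp P1 f) (wp P2 f))"
| "wp (While G P) = (\<lambda>f. lfp (\<lambda>h. mix (chi G) (wp P h) f))"

primrec (nonexhaustive) wlp :: "('var, 'v) prog \<Rightarrow> ('var, 'v) bexpec \<Rightarrow> ('var, 'v) bexpec" where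
  "wlp Skip = (\<lambda>f. f)"
| "wlp Abort = (\<lambda>f \<sigma>. 1)"
| "wlp (Assign x E) = (\<lambda>f. subst f x E)"
| "wlp (Seq P1 P2) = wlp P1 \<circ> wlp P2"
| "wlp (Ite G P1 P2) = (\<lambda>f. bmix (chi G) (wlp P1 f) (wlp P2 f))"
| "wlp (PChoice P1 p P2) = (\<lambda>f. bmix (\<lambda>\<sigma>. p) (wlp P1 f) (wlp P2 f))"
| "wlp (While G P) = (\<lambda>f. gfp (\<lambda>h. bmix (chi G) (wlp P h) f))"

text \<open>The loop of \<open>cwp\<close> is a least fixed point with respect to the order that is reversed in the
  second component, hence the excursion through the type constructor \<open>dual\<close>.\<close>

primrec cwp :: "('var, 'v) prog \<Rightarrow> ('var, 'v) expec \<times> ('var, 'v) bexpec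
    \<Rightarrow> ('var, 'v) expec \<times> ('var, 'v) bexpec" where
  "cwp Skip = (\<lambda>fg. fg)"
| "cwp Abort = (\<lambda>fg. (\<lambda>\<sigma>. 0, \<lambda>\<sigma>. 1))"
| "cwp (Assign x E) = (\<lambda>(f, g). (subst f x E, subst g x E))"
| "cwp (Observe G) = (\<lambda>(f, g). (\<lambda>\<sigma>. val (chi G \<sigma>) * f \<sigma>, \<lambda>\<sigma>. chi G \<sigma> * g \<sigma>))"
| "cwp (Seq P1 P2) = cwp P1 \<circ> cwp P2"
| "cwp (Ite G P1 P2) = (\<lambda>fg. mix_pair (chi G) (cwp P1 fg) (cwp P2 fg))"
| "cwp (PChoice P1 p P2) = (\<lambda>fg. mix_pair (\<lambda>\<sigma>. p) (cwp P1 fg) (cwp P2 fg))"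
| "cwp (While G P) = (\<lambda>fg. map_prod id undual
    (lfp (\<lambda>h. map_prod id dual (mix_pair (chi G) (cwp P (map_prod id undual h)) fg))))"

primrec cwlp :: "('var, 'v) prog \<Rightarrow> ('var, 'v) bexpec \<times> ('var, 'v) bexpec
    \<Rightarrow> ('var, 'v) bexpec \<times> ('var, 'v) bexpec" where
  "cwlp Skip = (\<lambda>fg. fg)"
| "cwlp Abort = (\<lambda>fg. (\<lambda>\<sigma>. 1, \<lambda>\<sigma>. 1))"
| "cwlp (Assign x E) = (\<lambda>(f, g). (subst f x E, subst g x E))"
| "cwlp (Observe G) = (\<lambda>(f, g). (\<lambda>\<sigma>. chi G \<sigma> * f \<sigma>, \<lambda>\<sigma>. chi G \<sigma> * g \<sigma>))"
| "cwlp (Seq P1 P2) = cwlp P1 \<circ> cwlp P2"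
| "cwlp (Ite G P1 P2) = (\<lambda>fg. bmix_pair (chi G) (cwlp P1 fg) (cwlp P2 fg))"
| "cwlp (PChoice P1 p P2) = (\<lambda>fg. bmix_pair (\<lambda>\<sigma>. p) (cwlp P1 fg) (cwlp P2 fg))"
| "cwlp (While G P) = (\<lambda>fg. gfp (\<lambda>h. bmix_pair (chi G) (cwlp P h) fg))"

text \<open>Quotients in \<open>[0,\<infinity>]\<close>, where \<open>None\<close> stands for an undefined quotient (denominator 0).\<close>

definition quot :: "ennreal \<Rightarrow> ennreal \<Rightarrow> ennreal option" where
  "quot a b = (if b = 0 then None else Some (a / b))"

definition cond_wp :: "('var, 'v) prog \<Rightarrow> ('var, 'v) expec \<Rightarrow> ('var, 'v) state \<Rightarrow> ennreal option"
  where "cond_wp P f = (\<lambda>\<sigma>. quot (fst (cwp P (f, \<lambda>_. 1)) \<sigma>) (val (snd (cwp P (f, \<lambda>_. 1)) \<sigma>)))"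

definition cond_wlp :: "('var, 'v) prog \<Rightarrow> ('var, 'v) bexpec \<Rightarrow> ('var, 'v) state \<Rightarrow> ennreal option"
  where "cond_wlp P g =
    (\<lambda>\<sigma>. quot (val (fst (cwlp P (g, \<lambda>_. 1)) \<sigma>)) (val (snd (cwlp P (g, \<lambda>_. 1)) \<sigma>)))"

end

(* Without observations the two components of cwp never interact: cwp P is the product of wp P and
   wlp P, and cwlp P is the product of wlp P with itself. For loops this holds because an extremal
   fixed point of a product map is the pair of extremal fixed points. Both denominators are thus
   wlp P 1 = 1. *)

theory Submission
  imports Defs
begin

text \<open>The pre-fixed points of a product map form a product set, and infima of pairs are taken
  componentwise.\<close>

lemma lfp_map_prod: "lfp (map_prod F G) = (lfp F, lfp G)"
  for F :: "'a::complete_lattice \<Rightarrow> 'a" and G :: "'b::complete_lattice \<Rightarrow> 'b"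
proof -
  have *: "{u. map_prod F G u \<le> u} = {x. F x \<le> x} \<times> {y. G y \<le> y}"
    by (auto simp: less_eq_prod_def)
  \<comment> \<open>A product set projects onto all of one factor only if the other factor is
    nonempty.\<close>
  have "F top \<le> top" "G top \<le> top" by simp_all
  then have ne: "{x. F x \<le> x} \<noteq> {}" "{y. G y \<le> y} \<noteq> {}" by blast+
  show ?thesis unfolding lfp_def * by (rule prod_eqI) (simp_all only: fst_Inf snd_Inf fst_image_times snd_image_times ne if_False fst_conv snd_conv)
qed

lemma gfp_map_prod: "gfp (map_prod F G) = (gfp F, gfp G)"
  for F :: "'a::complete_lattice \<Rightarrow> 'a" and G :: "'b::complete_lattice \<Rightarrow> 'b"
proof -
  have *: "{u. u \<le> map_prod F G u} = {x. x \<le> F x} \<times> {y. y \<le> G y}"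
    by (auto simp: less_eq_prod_def)
  have "bot \<le> F bot" "bot \<le> G bot" by simp_all
  then have ne: "{x. x \<le> F x} \<noteq> {}" "{y. y \<le> G y} \<noteq> {}" by blast+
  show ?thesis unfolding gfp_def * by (rule prod_eqI) (simp_all only: fst_Sup snd_Sup fst_image_times snd_image_times ne if_False fst_conv snd_conv)
qed

text \<open>Reversing the order turns pre-fixed into post-fixed points and infima into suprema. This
  serves the second component of \<open>cwp\<close> loops.\<close>

lemma lfp_dual: "lfp (\<lambda>h. dual (F (undual h))) = dual (gfp F)"
  for F :: "'a::complete_lattice \<Rightarrow> 'a"
proof -
  have *: "{u. dual (F (undual u)) \<le> u} = undual -` {x. x \<le> F x}"
    by (auto simp: dual_less_eq_iff)
  have "undual ` (undual -` {x. x \<le> F x}) = {x. x \<le> F x}"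
    by (rule surj_image_vimage_eq) (rule surj_undual)
  then show ?thesis unfolding lfp_def gfp_def * by (intro dual_eqI) (simp add: image_image)
qed

lemma cwp_observe_free:
  assumes "observe_free P"
  shows "cwp P (f, g) = (wp P f, wlp P g)"
  using assms
proof (induction P arbitrary: f g)
  case (While G P)
  \<comment> \<open>The induction hypothesis, used at every pair \<open>h\<close>, decouples the
    loop functional.\<close>
  have "(\<lambda>h. map_prod id dual (mix_pair (chi G) (cwp P (map_prod id undual h)) (f, g)))
    = map_prod (\<lambda>h. mix (chi G) (wp P h) f) (\<lambda>h. dual (bmix (chi G) (wlp P (undual h)) g))"
    using While by (auto simp: mix_pair_def)
  then show ?case
    by (simp add: lfp_map_prod lfp_dual[of "\<lambda>h. bmix (chi G) (wlp P h) g"])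
qed (auto simp: mix_pair_def)

lemma cwlp_observe_free:
  assumes "observe_free P"
  shows "cwlp P (f, g) = (wlp P f, wlp P g)"
  using assms
proof (induction P arbitrary: f g)
  case (While G P)
  have "(\<lambda>h. bmix_pair (chi G) (cwlp P h) (f, g))
    = map_prod (\<lambda>h. bmix (chi G) (wlp P h) f) (\<lambda>h. bmix (chi G) (wlp P h) g)"
    using While by (auto simp: bmix_pair_def)
  then show ?case
    by (simp add: gfp_map_prod)
qed (auto simp: bmix_pair_def)

lemma bmix_same: "bmix w g g = g"
  unfolding bmix_def
  \<comment> \<open>Subtraction in \<open>ennreal\<close> truncates at 0; the weights sum to 1
    because \<open>w\<close> is at most 1.\<close>
  by (rule ext, transfer) (simp add: add_diff_inverse_ennreal flip: distrib_right)

lemma wlp_one: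
  assumes "observe_free P"
  shows "wlp P (\<lambda>_. 1) = (\<lambda>_. 1)"
  using assms
proof (induction P)
  case (While G P)
  have top: "top = (\<lambda>_. 1 :: unit_ival)"
    by (rule ext) (simp add: top_unit_ival_def one_unit_ival_def)
  \<comment> \<open>Coinduction: a post-fixed point lies below \<open>gfp\<close>, and the constant
    1 is the top element, so equality follows.\<close>
  from While have "(\<lambda>_. 1) \<le> bmix (chi G) (wlp P (\<lambda>_. 1)) (\<lambda>_. 1)"
    by (simp add: bmix_same)
  then have "(\<lambda>_. 1) \<le> wlp (While G P) (\<lambda>_. 1)"
    by (simp add: gfp_upperbound)
  then show ?case unfolding top[symmetric] by (rule top_le)
qed (auto simp: subst_def bmix_same)

theorem theoremV2:
  fixes P :: "('var, 'v) prog"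
    and f :: "('var, 'v) state \<Rightarrow> ennreal"
    and g :: "('var, 'v) state \<Rightarrow> unit_ival"
  assumes "observe_free P"
  shows "(\<forall>\<sigma>. cond_wp P f \<sigma> = Some (wp P f \<sigma>)) \<and>
         (\<forall>\<sigma>. cond_wlp P g \<sigma> = Some (val (wlp P g \<sigma>)))"
  using assms
  by (simp add: cond_wp_def cond_wlp_def quot_def cwp_observe_free cwlp_observe_free wlp_one
      one_unit_ival.rep_eq divide_ennreal_def)

end
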